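(* Let $\mathbf A\in\mathbb R^{m\times n}$ be a nonzero matrix with rank $r$ and nonzero singular values $\sigma_1(\mathbf A)\ge\cdots\ge\sigma_r(\mathbf A)>0$, and let $\mathbf b\in\mathbb R^m$ be arbitrary (the system $\mathbf A\mathbf x=\mathbf b$ may be consistent or inconsistent). Fix any row partition, any column partition, any step size $\alpha>0$, and any initial vector $\mathbf x^0\in\mathbb R^n$, and let $\mathbf x^k$ denote the $k$th iterate of the doubly stochastic block Gauss--Seidel (DSBGS) algorithm described in the context. Let $\mathbf x_\star$ be any solution of the normal equations $\mathbf A^T\mathbf A\mathbf x=\mathbf A^T\mathbf b$. Then for every $k\ge0$, $$\big\|\mathbb E[\mathbf A\mathbf x^k-\mathbf A\mathbf x_\star]\big\|_2\le\Big(\max_{1\le i\le r}\Big|1-\frac{\alpha\sigma_i^2(\mathbf A)}{\|\mathbf A\|_F^2}\Big|\Big)^k\|\mathbf A\mathbf x^0-\mathbf A\mathbf x_\star\|_2 .$$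
   Context: Notation: $\|\cdot\|_F$ the Frobenius norm, $\|\cdot\|_2$ the Euclidean norm. For $\mathcal I\subseteq[m]=\{1,\dots,m\}$ and $\mathcal J\subseteq[n]$, $\mathbf A_{\mathcal I,\mathcal J}$ is the submatrix of $\mathbf A$ with rows indexed by $\mathcal I$ and columns indexed by $\mathcal J$; $\mathbf I_{:,\mathcal J}$ denotes the columns of the identity matrix (of the appropriate order) indexed by $\mathcal J$. DSBGS algorithm: Let $\{\mathcal I_1,\dots,\mathcal I_s\}$ be a partition of $[m]$ into nonempty pairwise disjoint sets and $\{\mathcal J_1,\dots,\mathcal J_t\}$ a partition of $[n]$ into nonempty pairwise disjoint sets; let $\mathcal P=\{\mathcal I_1,\dots,\mathcal I_s\}\times\{\mathcal J_1,\dots,\mathcal J_t\}$. Given $\alpha>0$ and $\mathbf x^0\in\mathbb R^n$, for $k=1,2,\dots$: pick $(\mathcal I,\mathcal J)\in\mathcal P$ (independently of the previous choices) with probability $\|\mathbf A_{\mathcal I,\mathcal J}\|_F^2/\|\mathbf A\|_F^2$, and set $$\mathbf x^k=\mathbf x^{k-1}-\alpha\,\frac{\mathbf I_{:,\mathcal J}(\mathbf A_{\mathcal I,\mathcal J})^{T}(\mathbf I_{:,\mathcal I})^{T}}{\|\mathbf A_{\mathcal I,\mathcal J}\|_F^2}\,(\mathbf A\mathbf x^{k-1}-\mathbf b).$$ The expectation $\mathbb E$ is over the random choices of the blocks. *)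

theory Defs
  imports "HOL-Analysis.Analysis"
begin

(* eigenvalue of a real square matrix *)
definition mat_eigenvalue :: "real^'n^'n \<Rightarrow> real \<Rightarrow> bool" where
  "mat_eigenvalue M c \<longleftrightarrow> (\<exists>v. v \<noteq> 0 \<and> M *v v = c *\<^sub>R v)"

(* nonzero singular values of A: sigma > 0 with sigma^2 an eigenvalue of A^T A *)
definition nonzero_singular_values :: "real^'n^'m \<Rightarrow> real set" where
  "nonzero_singular_values A = {\<sigma>. \<sigma> > 0 \<and> mat_eigenvalue (transpose A ** A) (\<sigma>\<^sup>2)}"

(* squared Frobenius norm of the submatrix A_{I,J} *)
definition frob_sq_block :: "real^'n^'m \<Rightarrow> 'm set \<Rightarrow> 'n set \<Rightarrow> real" where
  "frob_sq_block A I J = (\<Sum>i\<in>I. \<Sum>j\<in>J. (A $ i $ j)\<^sup>2)"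

definition frob_sq :: "real^'n^'m \<Rightarrow> real" where
  "frob_sq A = frob_sq_block A UNIV UNIV"

(* partition of a finite type's index set into nonempty pairwise disjoint sets *)
definition is_partition :: "'a set set \<Rightarrow> bool" where
  "is_partition P \<longleftrightarrow> {} \<notin> P \<and> \<Union>P = UNIV \<and>
     (\<forall>X\<in>P. \<forall>Y\<in>P. X \<noteq> Y \<longrightarrow> X \<inter> Y = {})"

(* one DSBGS step with chosen block (I,J):
   x - alpha * I_{:,J} (A_{I,J})^T (I_{:,I})^T (A x - b) / ||A_{I,J}||_F^2 *)
definition dsbgs_step :: "real \<Rightarrow> real^'n^'m \<Rightarrow> real^'m \<Rightarrow> real^'n \<Rightarrow> 'm set \<times> 'n set \<Rightarrow> real^'n" where
  "dsbgs_step \<alpha> A b x IJ =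
     (let I = fst IJ; J = snd IJ; r = A *v x - b in
      x - (\<alpha> / frob_sq_block A I J) *\<^sub>R
        (\<chi> j. if j \<in> J then (\<Sum>i\<in>I. A $ i $ j * r $ i) else 0))"

(* iterate after the sequence of block choices ss (ss ! 0 is the first choice) *)
definition dsbgs_iter :: "real \<Rightarrow> real^'n^'m \<Rightarrow> real^'m \<Rightarrow> real^'n \<Rightarrow> ('m set \<times> 'n set) list \<Rightarrow> real^'n" where
  "dsbgs_iter \<alpha> A b x0 ss = foldl (dsbgs_step \<alpha> A b) x0 ss"

(* probability of choosing block (I,J) *)
definition block_prob :: "real^'n^'m \<Rightarrow> 'm set \<times> 'n set \<Rightarrow> real" where
  "block_prob A IJ = frob_sq_block A (fst IJ) (snd IJ) / frob_sq A"

(* expectation of x^k over k independent block choices from P = Rows x Cols *)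
definition dsbgs_expect ::
  "'m set set \<Rightarrow> 'n set set \<Rightarrow> real \<Rightarrow> real^'n^'m \<Rightarrow> real^'m \<Rightarrow> real^'n \<Rightarrow> nat \<Rightarrow> real^'n" where
  "dsbgs_expect Rows Cols \<alpha> A b x0 k =
     (\<Sum>ss\<in>{ss. set ss \<subseteq> Rows \<times> Cols \<and> length ss = k}.
        (\<Prod>p\<leftarrow>ss. block_prob A p) *\<^sub>R dsbgs_iter \<alpha> A b x0 ss)"

end

theory Submission
  imports Defs
begin

(* Averaging one DSBGS step over the block distribution gives the full Landweber step
   x - c A^T (A x - b), c = alpha / |A|_F^2: the probability of block (I, J) cancels its normalisation
   and the blocks tile A. As this step is affine, E[x^k] is the k-th Landweber iterate, so by the normal
   equations the residual A E[x^k] - A x_* is multiplied at each step by the symmetric map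
   T = I - c A A^T, which leaves range A invariant. The norm of T on range A is attained at an
   eigenvector (found from a maximiser of |T y| on the unit sphere of range A), and an eigenvector of
   T in range A has eigenvalue 1 - c sigma^2 for a nonzero singular value sigma of A. *)

section \<open>Norms of self-adjoint maps on invariant subspaces\<close>

lemma nonneg_quadratic_imp_linear_coeff_zero:
  fixes a b :: real
  assumes "\<And>t. 0 \<le> t * a + t\<^sup>2 * b"
  shows "a = 0"
proof (rule ccontr)
  assume "a \<noteq> 0"
  define B where "B = \<bar>b\<bar> + 1"
  have "B > 0" "b < B" by (simp_all add: B_def)
  have "0 \<le> ((- a / B) * a + (- a / B)\<^sup>2 * b) * B\<^sup>2"
    using assms[of "- a / B"] by simp
  also have "\<dots> = a\<^sup>2 * (b - B)"
    using \<open>B > 0\<close> by (simp add: field_simps power2_eq_square)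
  also have "\<dots> < 0"
    using \<open>a \<noteq> 0\<close> \<open>b < B\<close> by (simp add: mult_pos_neg)
  finally show False by simp
qed

lemma selfadjoint_nonneg_form_zero_imp_zero:
  fixes S :: "'a::real_inner \<Rightarrow> 'a"
  assumes "linear S" and S_sym: "\<And>x y. S x \<bullet> y = x \<bullet> S y"
    and "subspace R" and nonneg: "\<And>y. y \<in> R \<Longrightarrow> 0 \<le> y \<bullet> S y"
    and "x \<in> R" "S x \<in> R" and "x \<bullet> S x = 0"
  shows "S x = 0"
proof -
  define w where "w = S x"
  have "0 \<le> t * (2 * (w \<bullet> w)) + t\<^sup>2 * (w \<bullet> S w)" for t
  proof -
    have "x + t *\<^sub>R w \<in> R"
      using assms(3,5,6) by (simp add: w_def subspace_add subspace_scale)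
    then have "0 \<le> (x + t *\<^sub>R w) \<bullet> S (x + t *\<^sub>R w)"
      by (rule nonneg)
    also have "\<dots> = t * (2 * (w \<bullet> w)) + t\<^sup>2 * (w \<bullet> S w)"
      using \<open>x \<bullet> S x = 0\<close> S_sym[of x w] \<open>linear S\<close>
      by (simp add: w_def linear_add linear_scale inner_add_left inner_add_right
          inner_commute power2_eq_square algebra_simps)
    finally show ?thesis .
  qed
  then have "w \<bullet> w = 0"
    using nonneg_quadratic_imp_linear_coeff_zero by fastforce
  then show ?thesis by (simp add: w_def)
qed

lemma eigenvector_of_square_eigenvector:
  fixes T :: "'a::real_vector \<Rightarrow> 'a"
  assumes "linear T" and "T (T y) = (s * s) *\<^sub>R y" and "y \<noteq> 0"
  shows "\<exists>v\<in>{y, T y + s *\<^sub>R y}. v \<noteq> 0 \<and> (T v = s *\<^sub>R v \<or> T v = (- s) *\<^sub>R v)"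
proof (cases "T y + s *\<^sub>R y = 0")
  case True
  then have "T y = (- s) *\<^sub>R y"
    by (simp add: eq_neg_iff_add_eq_0)
  then show ?thesis using \<open>y \<noteq> 0\<close> by blast
next
  case False
  have "T (T y + s *\<^sub>R y) = s *\<^sub>R (T y + s *\<^sub>R y)"
    using assms(1,2) by (simp add: linear_add linear_scale algebra_simps)
  then show ?thesis using False by blast
qed

lemma linear_norm_attains_max_on_subspace:
  fixes T :: "'a::euclidean_space \<Rightarrow> 'b::real_normed_vector"
  assumes "linear T" and "subspace R" and "R \<noteq> {0}"
  obtains y0 where "y0 \<in> R" "norm y0 = 1" "\<And>y. y \<in> R \<Longrightarrow> norm (T y) \<le> norm (T y0) * norm y"
proof -
  let ?S = "R \<inter> sphere 0 1"
  obtain y1 where "y1 \<in> R" "y1 \<noteq> 0"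
    using \<open>R \<noteq> {0}\<close> \<open>subspace R\<close> subspace_0 by blast
  then have "y1 /\<^sub>R norm y1 \<in> ?S"
    using \<open>subspace R\<close> by (simp add: subspace_scale)
  moreover have "compact ?S"
    using \<open>subspace R\<close> by (intro closed_Int_compact closed_subspace compact_sphere)
  moreover have "continuous_on ?S (\<lambda>y. norm (T y))"
    using \<open>linear T\<close> by (intro continuous_intros linear_continuous_on linear_conv_bounded_linear[THEN iffD1])
  ultimately obtain y0 where y0: "y0 \<in> ?S" and y0_max: "\<And>y. y \<in> ?S \<Longrightarrow> norm (T y) \<le> norm (T y0)"
    using continuous_attains_sup[of ?S "\<lambda>y. norm (T y)"] by blast
  have bound: "norm (T y) \<le> norm (T y0) * norm y" if "y \<in> R" for y
  proof (cases "y = 0")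
    case True
    then show ?thesis using \<open>linear T\<close> by (simp add: linear_0)
  next
    case False
    have "y /\<^sub>R norm y \<in> ?S"
      using that False \<open>subspace R\<close> by (simp add: subspace_scale)
    then have "norm (T (y /\<^sub>R norm y)) \<le> norm (T y0)"
      by (rule y0_max)
    then show ?thesis
      using False \<open>linear T\<close> by (simp add: linear_scale field_simps)
  qed
  show ?thesis
    by (rule that[of y0]) (use y0 bound in auto)
qed

lemma selfadjoint_norm_bound_attained_at_eigenvector:
  fixes T :: "'a::euclidean_space \<Rightarrow> 'a"
  assumes "linear T" and T_sym: "\<And>x y. T x \<bullet> y = x \<bullet> T y"
    and "subspace R" and T_R: "\<And>y. y \<in> R \<Longrightarrow> T y \<in> R" and "R \<noteq> {0}"
  obtains v l where "v \<in> R" "v \<noteq> 0" "T v = l *\<^sub>R v" "\<And>y. y \<in> R \<Longrightarrow> norm (T y) \<le> \<bar>l\<bar> * norm y"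
proof -
  obtain y0 where y0: "y0 \<in> R" "norm y0 = 1" and bound: "\<And>y. y \<in> R \<Longrightarrow> norm (T y) \<le> norm (T y0) * norm y"
    using linear_norm_attains_max_on_subspace[OF \<open>linear T\<close> \<open>subspace R\<close> \<open>R \<noteq> {0}\<close>] by blast
  define \<mu> where "\<mu> = norm (T y0)"
  (* \<mu>\<^sup>2 - T\<^sup>2 is positive semidefinite on R and its quadratic form vanishes at the maximiser y0 *)
  define S where "S y = \<mu>\<^sup>2 *\<^sub>R y - T (T y)" for y
  have "S y0 = 0"
  proof (rule selfadjoint_nonneg_form_zero_imp_zero[where S = S and R = R and x = y0])
    show "linear S"
      using \<open>linear T\<close> by (intro linearI) (simp_all add: S_def linear_add linear_scale algebra_simps)
    show "S x \<bullet> y = x \<bullet> S y" for x y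
      using T_sym[of x "T y"] T_sym[of "T x" y]
      by (simp add: S_def inner_diff_left inner_diff_right)
    show "0 \<le> y \<bullet> S y" if "y \<in> R" for y
    proof -
      have "(norm (T y))\<^sup>2 \<le> (\<mu> * norm y)\<^sup>2"
        using bound[OF that, folded \<mu>_def] by (simp add: power_mono)
      then show ?thesis
        using T_sym[of y "T y", symmetric] by (simp add: S_def inner_diff_right power_mult_distrib dot_square_norm)
    qed
    show "y0 \<bullet> S y0 = 0"
      using y0 T_sym[of y0 "T y0", symmetric] by (simp add: S_def \<mu>_def inner_diff_right dot_square_norm)
    show "y0 \<in> R" "S y0 \<in> R"
      using y0 T_R \<open>subspace R\<close> by (simp_all add: S_def subspace_diff subspace_scale)
  qed (fact \<open>subspace R\<close>)+
  then have "T (T y0) = (\<mu> * \<mu>) *\<^sub>R y0"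
    by (simp add: S_def power2_eq_square)
  then obtain v where v: "v \<in> {y0, T y0 + \<mu> *\<^sub>R y0}" "v \<noteq> 0" "T v = \<mu> *\<^sub>R v \<or> T v = (- \<mu>) *\<^sub>R v"
    using eigenvector_of_square_eigenvector[OF \<open>linear T\<close>] y0 by fastforce
  have "v \<in> R"
    using v(1) y0 T_R \<open>subspace R\<close> by (auto simp: subspace_add subspace_scale)
  moreover have "\<mu> = \<bar>\<mu>\<bar>" "\<mu> = \<bar>- \<mu>\<bar>"
    by (simp_all add: \<mu>_def)
  ultimately show ?thesis
    using that v(2,3) bound[folded \<mu>_def] by metis
qed

section \<open>Nonzero singular values\<close>

lemma inner_matrix_vector_adjoint:
  fixes A :: "real^'n^'m"
  shows "(A *v x) \<bullet> y = x \<bullet> (transpose A *v y)" and "y \<bullet> (A *v x) = (transpose A *v y) \<bullet> x"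
  by (metis dot_lmul_matrix inner_commute transpose_matrix_vector)+

lemma nonzero_singular_value_of_range_eigenvector:
  fixes A :: "real^'n^'m"
  assumes "v \<in> range ((*v) A)" and "v \<noteq> 0" and eig: "A *v (transpose A *v v) = t *\<^sub>R v"
  shows "t > 0" and "sqrt t \<in> nonzero_singular_values A"
proof -
  define z where "z = transpose A *v v"
  obtain x where x: "v = A *v x" using assms(1) by blast
  have "v \<bullet> v = x \<bullet> z"
    unfolding z_def x by (rule inner_matrix_vector_adjoint(1))
  then have "z \<noteq> 0" using \<open>v \<noteq> 0\<close> by auto
  have "z \<bullet> z = t * (v \<bullet> v)"
    unfolding z_def by (simp only: inner_matrix_vector_adjoint(2)[where A = A, symmetric] eig inner_scaleR_right)
  then show "t > 0"
    using \<open>z \<noteq> 0\<close> \<open>v \<noteq> 0\<close> by (metis inner_gt_zero_iff zero_less_mult_pos2)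
  have "(transpose A ** A) *v z = transpose A *v (t *\<^sub>R v)"
    by (simp only: z_def matrix_vector_mul_assoc[symmetric] eig)
  also have "\<dots> = (sqrt t)\<^sup>2 *\<^sub>R z"
    using \<open>t > 0\<close> by (simp only: z_def matrix_vector_mult_scaleR real_sqrt_pow2 less_imp_le)
  finally show "sqrt t \<in> nonzero_singular_values A"
    using \<open>t > 0\<close> \<open>z \<noteq> 0\<close> by (auto simp: nonzero_singular_values_def mat_eigenvalue_def)
qed

lemma range_matrix_vector_mult_nontrivial:
  fixes A :: "real^'n^'m"
  assumes "A \<noteq> 0"
  shows "range ((*v) A) \<noteq> {0}"
  using assms matrix_eq[of A 0] by auto

lemma residual_map_norm_le_on_range:
  fixes A :: "real^'n^'m"
  assumes "A \<noteq> 0" and "c > 0"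
  obtains \<sigma> where "\<sigma> \<in> nonzero_singular_values A"
    "\<And>y. y \<in> range ((*v) A) \<Longrightarrow>
       norm (y - c *\<^sub>R (A *v (transpose A *v y))) \<le> \<bar>1 - c * \<sigma>\<^sup>2\<bar> * norm y"
proof -
  define T where "T y = y - c *\<^sub>R (A *v (transpose A *v y))" for y
  have "linear T"
    by (intro linearI) (simp_all add: T_def matrix_vector_right_distrib matrix_vector_mult_scaleR algebra_simps)
  moreover have "T x \<bullet> y = x \<bullet> T y" for x y
    by (simp only: T_def inner_diff_left inner_diff_right inner_scaleR_left inner_scaleR_right
        inner_matrix_vector_adjoint[where A = A] inner_commute[of x y])
  moreover have "subspace (range ((*v) A))"
    by (rule subspace_UNIV[THEN linear_subspace_image[OF matrix_vector_mul_linear]])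
  moreover have "T y \<in> range ((*v) A)" if y: "y \<in> range ((*v) A)" for y
  proof -
    obtain x where "y = A *v x" using y by blast
    then have "T y = A *v (x - c *\<^sub>R (transpose A *v y))"
      by (simp add: T_def matrix_vector_mult_diff_distrib matrix_vector_mult_scaleR)
    then show ?thesis by simp
  qed
  ultimately obtain v l where v: "v \<in> range ((*v) A)" "v \<noteq> 0" "T v = l *\<^sub>R v"
    and bound: "\<And>y. y \<in> range ((*v) A) \<Longrightarrow> norm (T y) \<le> \<bar>l\<bar> * norm y"
    using selfadjoint_norm_bound_attained_at_eigenvector range_matrix_vector_mult_nontrivial[OF \<open>A \<noteq> 0\<close>]
    by metis
  define t where "t = (1 - l) / c"
  have "c *\<^sub>R (A *v (transpose A *v v)) = v - T v"
    by (simp add: T_def)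
  also have "\<dots> = c *\<^sub>R (t *\<^sub>R v)"
    using v(3) \<open>c > 0\<close> by (simp add: t_def scaleR_diff_left)
  finally have "A *v (transpose A *v v) = t *\<^sub>R v"
    using \<open>c > 0\<close> by (metis scaleR_cancel_left less_irrefl)
  then have "t > 0" and \<sigma>: "sqrt t \<in> nonzero_singular_values A"
    using nonzero_singular_value_of_range_eigenvector[OF v(1,2)] by blast+
  then have "\<bar>1 - c * (sqrt t)\<^sup>2\<bar> = \<bar>l\<bar>"
    using \<open>c > 0\<close> by (simp add: t_def)
  with \<sigma> show ?thesis
    using that bound unfolding T_def by metis
qed

lemma eigenvector_combination_eq_0_imp_coeffs_eq_0:
  fixes f :: "'a::real_vector \<Rightarrow> 'a"
  assumes "linear f" and "finite S"
    and eig: "\<And>c. c \<in> S \<Longrightarrow> v c \<noteq> 0 \<and> f (v c) = c *\<^sub>R v c"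
    and "(\<Sum>c\<in>S. a c *\<^sub>R v c) = 0"
  shows "\<forall>c\<in>S. a c = 0"
  using assms(2-)
proof (induction S arbitrary: a rule: finite_induct)
  case empty
  then show ?case by simp
next
  case (insert d S)
  have comb: "a d *\<^sub>R v d + (\<Sum>c\<in>S. a c *\<^sub>R v c) = 0"
    using insert by simp
  have "(\<Sum>c\<in>S. (a c * (c - d)) *\<^sub>R v c) = f (a d *\<^sub>R v d + (\<Sum>c\<in>S. a c *\<^sub>R v c)) - d *\<^sub>R (a d *\<^sub>R v d + (\<Sum>c\<in>S. a c *\<^sub>R v c))"
    using insert.prems(1) \<open>linear f\<close>
    by (simp add: linear_add linear_sum linear_scale algebra_simps scaleR_sum_right sum_subtractf)
  also have "\<dots> = 0"
    using comb \<open>linear f\<close> by (simp add: linear_0)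
  finally have "\<forall>c\<in>S. a c * (c - d) = 0"
    using insert by (intro insert.IH) auto
  then have "\<forall>c\<in>S. a c = 0"
    using insert.hyps(2) by auto
  moreover from this have "a d = 0"
    using comb insert.prems(1) by simp
  ultimately show ?case by simp
qed

lemma finite_mat_eigenvalues: "finite {c. mat_eigenvalue (M::real^'n^'n) c}"
proof (rule ccontr)
  let ?E = "{c. mat_eigenvalue M c}"
  assume "infinite ?E"
  then obtain S where S: "S \<subseteq> ?E" "finite S" "card S = Suc CARD('n)"
    using infinite_arbitrarily_large by blast
  define v where "v c = (SOME v. v \<noteq> 0 \<and> M *v v = c *\<^sub>R v)" for c
  have eig: "v c \<noteq> 0 \<and> M *v v c = c *\<^sub>R v c" if "c \<in> S" for c
    unfolding v_def by (rule someI_ex) (use that S(1) mat_eigenvalue_def in blast)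
  have "inj_on v S"
    by (rule inj_onI) (metis eig scaleR_cancel_right)
  have "independent (v ` S)"
  proof
    assume "dependent (v ` S)"
    then obtain u where u: "\<exists>w\<in>v ` S. u w \<noteq> 0" "(\<Sum>w\<in>v ` S. u w *\<^sub>R w) = 0"
      using \<open>finite S\<close> by (auto simp: real_vector.dependent_finite)
    then have "(\<Sum>c\<in>S. u (v c) *\<^sub>R v c) = 0"
      by (simp add: sum.reindex[OF \<open>inj_on v S\<close>])
    then have "\<forall>c\<in>S. u (v c) = 0"
      by (intro eigenvector_combination_eq_0_imp_coeffs_eq_0[where f = "(*v) M"])
        (simp_all add: \<open>finite S\<close> eig)
    then show False using u(1) by auto
  qed
  then have "card (v ` S) \<le> CARD('n)"
    using independent_bound by fastforce
  then show False
    using S(3) card_image[OF \<open>inj_on v S\<close>] by simp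
qed

lemma finite_nonzero_singular_values: "finite (nonzero_singular_values A)"
proof (rule finite_subset)
  show "nonzero_singular_values A \<subseteq> sqrt ` {c. mat_eigenvalue (transpose A ** A) c}"
    by (auto simp: nonzero_singular_values_def intro!: image_eqI[where x = "_\<^sup>2"])
qed (rule finite_imageI[OF finite_mat_eigenvalues])

section \<open>The expected DSBGS iterate\<close>

lemma sum_partition:
  fixes P :: "'a::finite set set" and f :: "'a \<Rightarrow> 'b::comm_monoid_add"
  assumes "is_partition P"
  shows "(\<Sum>I\<in>P. sum f I) = sum f UNIV"
  using sum.Union_disjoint[of P f] assms by (auto simp: is_partition_def)

lemma sum_partition_member:
  fixes P :: "'a::finite set set" and X :: "'b::comm_monoid_add"
  assumes "is_partition P"
  shows "(\<Sum>J\<in>P. if j \<in> J then X else 0) = X"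
proof -
  have "(\<Sum>J\<in>P. if j \<in> J then X else 0) = (\<Sum>J\<in>P. \<Sum>j'\<in>J. if j' = j then X else 0)"
    by (intro sum.cong refl) (simp add: sum.delta')
  also have "\<dots> = (\<Sum>j'\<in>UNIV. if j' = j then X else 0)"
    by (rule sum_partition[OF assms])
  also have "\<dots> = X"
    by (simp add: sum.delta')
  finally show ?thesis .
qed

lemma sum_frob_sq_block_partition:
  fixes A :: "real^'n::finite^'m::finite"
  assumes "is_partition Rows" and "is_partition Cols"
  shows "(\<Sum>(I, J)\<in>Rows \<times> Cols. frob_sq_block A I J) = frob_sq A"
proof -
  have "(\<Sum>(I, J)\<in>Rows \<times> Cols. frob_sq_block A I J) = (\<Sum>I\<in>Rows. \<Sum>i\<in>I. \<Sum>J\<in>Cols. \<Sum>j\<in>J. (A $ i $ j)\<^sup>2)"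
    unfolding frob_sq_block_def sum.cartesian_product[symmetric] by (intro sum.cong refl) (rule sum.swap)
  then show ?thesis
    by (simp add: sum_partition assms frob_sq_def frob_sq_block_def)
qed

lemma frob_sq_pos:
  fixes A :: "real^'n::finite^'m::finite"
  assumes "A \<noteq> 0"
  shows "frob_sq A > 0"
proof -
  obtain i j where "A $ i $ j \<noteq> 0"
    using assms by (metis vec_eq_iff zero_index)
  then have "frob_sq A \<noteq> 0"
    by (auto simp: frob_sq_def frob_sq_block_def sum_nonneg_eq_0_iff sum_nonneg)
  moreover have "frob_sq A \<ge> 0"
    by (simp add: frob_sq_def frob_sq_block_def sum_nonneg)
  ultimately show ?thesis by simp
qed

lemma sum_block_prob:
  fixes A :: "real^'n::finite^'m::finite"
  assumes "A \<noteq> 0" and "is_partition Rows" and "is_partition Cols"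
  shows "(\<Sum>p\<in>Rows \<times> Cols. block_prob A p) = 1"
  using sum_frob_sq_block_partition[OF assms(2,3), of A] frob_sq_pos[OF assms(1)]
  by (simp add: block_prob_def split_def sum_divide_distrib[symmetric])

definition landweber_step :: "real \<Rightarrow> real^'n^'m \<Rightarrow> real^'m \<Rightarrow> real^'n \<Rightarrow> real^'n" where
  "landweber_step c A b x = x - c *\<^sub>R (transpose A *v (A *v x - b))"

lemma sum_blocks_transpose_matrix_vector:
  fixes A :: "real^'n::finite^'m::finite"
  assumes Rows: "is_partition Rows" and Cols: "is_partition Cols"
  shows "(\<Sum>p\<in>Rows \<times> Cols. \<chi> j. if j \<in> snd p then \<Sum>i\<in>fst p. A $ i $ j * r $ i else 0)
       = transpose A *v r"
proof -
  have "(\<Sum>p\<in>Rows \<times> Cols. if j \<in> snd p then \<Sum>i\<in>fst p. A $ i $ j * r $ i else 0)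
      = (\<Sum>I\<in>Rows. \<Sum>J\<in>Cols. if j \<in> J then \<Sum>i\<in>I. A $ i $ j * r $ i else 0)" for j
    by (simp add: sum.cartesian_product split_def)
  also have "\<dots> j = (\<Sum>I\<in>Rows. \<Sum>i\<in>I. A $ i $ j * r $ i)" for j
    by (simp add: sum_partition_member[OF Cols])
  also have "\<dots> j = (transpose A *v r) $ j" for j
    by (simp add: sum_partition[OF Rows] matrix_vector_mult_def transpose_def)
  finally show ?thesis
    by (simp add: vec_eq_iff sum_component)
qed

lemma dsbgs_step_average:
  fixes A :: "real^'n::finite^'m::finite"
  assumes "A \<noteq> 0" and "is_partition Rows" and "is_partition Cols"
  shows "(\<Sum>p\<in>Rows \<times> Cols. block_prob A p *\<^sub>R dsbgs_step \<alpha> A b x p)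
       = landweber_step (\<alpha> / frob_sq A) A b x"
proof -
  define g where "g p = (\<chi> j. if j \<in> snd p then \<Sum>i\<in>fst p. A $ i $ j * (A *v x - b) $ i else 0)"
    for p :: "'m set \<times> 'n set"
  have weighted_step: "block_prob A p *\<^sub>R dsbgs_step \<alpha> A b x p = block_prob A p *\<^sub>R x - (\<alpha> / frob_sq A) *\<^sub>R g p"
    for p
  proof (cases "frob_sq_block A (fst p) (snd p) = 0")
    case True
    (* a zero block has zero probability and, by the convention x / 0 = 0, leaves x unchanged *)
    then have "\<forall>i\<in>fst p. \<forall>j\<in>snd p. A $ i $ j = 0"
      by (simp add: frob_sq_block_def sum_nonneg_eq_0_iff sum_nonneg)
    then have "g p = 0"
      by (simp add: g_def vec_eq_iff)
    then show ?thesis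
      using True by (simp add: dsbgs_step_def block_prob_def)
  next
    case False
    then have "block_prob A p * (\<alpha> / frob_sq_block A (fst p) (snd p)) = \<alpha> / frob_sq A"
      by (simp add: block_prob_def)
    then show ?thesis
      by (simp add: dsbgs_step_def Let_def g_def algebra_simps)
  qed
  show ?thesis
    using sum_block_prob[OF assms] sum_blocks_transpose_matrix_vector[OF assms(2,3)]
    by (simp add: weighted_step sum_subtractf scaleR_sum_right[symmetric] scaleR_sum_left[symmetric]
        landweber_step_def g_def)
qed

lemma lists_length_Suc_eq_image_snoc:
  "{ss. set ss \<subseteq> P \<and> length ss = Suc k}
     = (\<lambda>(ss, p). ss @ [p]) ` ({ss. set ss \<subseteq> P \<and> length ss = k} \<times> P)"
proof
  show "{ss. set ss \<subseteq> P \<and> length ss = Suc k}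
      \<subseteq> (\<lambda>(ss, p). ss @ [p]) ` ({ss. set ss \<subseteq> P \<and> length ss = k} \<times> P)"
  proof
    fix ss assume "ss \<in> {ss. set ss \<subseteq> P \<and> length ss = Suc k}"
    then obtain ys y where "ss = ys @ [y]" "length ys = k" "set ss \<subseteq> P"
      by (auto simp: length_Suc_conv_rev)
    then show "ss \<in> (\<lambda>(ss, p). ss @ [p]) ` ({ss. set ss \<subseteq> P \<and> length ss = k} \<times> P)"
      by (intro image_eqI[of _ _ "(ys, y)"]) auto
  qed
qed auto

lemma sum_lists_length_Suc:
  "(\<Sum>ss\<in>{ss. set ss \<subseteq> P \<and> length ss = Suc k}. h ss)
     = (\<Sum>ss\<in>{ss. set ss \<subseteq> P \<and> length ss = k}. \<Sum>p\<in>P. h (ss @ [p]))"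
proof -
  have snoc_inj: "inj_on (\<lambda>(ss, p). ss @ [p]) ({ss. set ss \<subseteq> P \<and> length ss = k} \<times> P)"
    by (rule inj_onI) auto
  show ?thesis
    unfolding lists_length_Suc_eq_image_snoc sum.reindex[OF snoc_inj]
    by (simp add: sum.cartesian_product split_beta comp_def)
qed

lemma sum_lists_prod_list:
  fixes w :: "'a \<Rightarrow> 'b::comm_semiring_1"
  shows "(\<Sum>ss\<in>{ss. set ss \<subseteq> P \<and> length ss = k}. \<Prod>p\<leftarrow>ss. w p) = (sum w P) ^ k"
proof (induction k)
  case 0
  have "{ss. set ss \<subseteq> P \<and> length ss = 0} = {[]}" by auto
  then show ?case by simp
next
  case (Suc k)
  have "(\<Sum>ss\<in>{ss. set ss \<subseteq> P \<and> length ss = Suc k}. \<Prod>p\<leftarrow>ss. w p)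
      = (\<Sum>ss\<in>{ss. set ss \<subseteq> P \<and> length ss = k}. (\<Prod>p\<leftarrow>ss. w p) * sum w P)"
    by (simp add: sum_lists_length_Suc sum_distrib_left[symmetric])
  also have "\<dots> = (sum w P) ^ Suc k"
    by (simp only: sum_distrib_right[symmetric] Suc.IH power_Suc2)
  finally show ?case .
qed

lemma sum_scaleR_affine:
  assumes "linear f" and "sum w S = 1"
  shows "(\<Sum>s\<in>S. w s *\<^sub>R (f (x s) + d)) = f (\<Sum>s\<in>S. w s *\<^sub>R x s) + d"
  using assms by (simp add: scaleR_add_right sum.distrib linear_sum linear_scale scaleR_sum_left[symmetric])

lemma landweber_step_average:
  assumes "sum w S = 1"
  shows "(\<Sum>s\<in>S. w s *\<^sub>R landweber_step c A b (x s)) = landweber_step c A b (\<Sum>s\<in>S. w s *\<^sub>R x s)"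
proof -
  define f where "f x = x - c *\<^sub>R (transpose A *v (A *v x))" for x
  have "linear f"
    by (intro linearI) (simp_all add: f_def matrix_vector_right_distrib matrix_vector_mult_scaleR algebra_simps)
  moreover have "landweber_step c A b x = f x + c *\<^sub>R (transpose A *v b)" for x
    by (simp add: landweber_step_def f_def matrix_vector_mult_diff_distrib algebra_simps)
  ultimately show ?thesis
    using sum_scaleR_affine[OF _ assms] by simp
qed

lemma dsbgs_expect_0: "dsbgs_expect Rows Cols \<alpha> A b x0 0 = x0"
proof -
  have "{ss. set ss \<subseteq> Rows \<times> Cols \<and> length ss = 0} = {[]}" by auto
  then show ?thesis by (simp add: dsbgs_expect_def dsbgs_iter_def)
qed

lemma dsbgs_expect_Suc:
  fixes A :: "real^'n::finite^'m::finite"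
  assumes "A \<noteq> 0" and "is_partition Rows" and "is_partition Cols"
  shows "dsbgs_expect Rows Cols \<alpha> A b x0 (Suc k)
       = landweber_step (\<alpha> / frob_sq A) A b (dsbgs_expect Rows Cols \<alpha> A b x0 k)"
proof -
  let ?L = "{ss. set ss \<subseteq> Rows \<times> Cols \<and> length ss = k}"
  let ?w = "\<lambda>ss. \<Prod>p\<leftarrow>ss. block_prob A p"
  let ?x = "dsbgs_iter \<alpha> A b x0"
  have "dsbgs_expect Rows Cols \<alpha> A b x0 (Suc k)
      = (\<Sum>ss\<in>?L. ?w ss *\<^sub>R (\<Sum>p\<in>Rows \<times> Cols. block_prob A p *\<^sub>R dsbgs_step \<alpha> A b (?x ss) p))"
    by (simp add: dsbgs_expect_def sum_lists_length_Suc dsbgs_iter_def scaleR_sum_right)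
  also have "\<dots> = (\<Sum>ss\<in>?L. ?w ss *\<^sub>R landweber_step (\<alpha> / frob_sq A) A b (?x ss))"
    by (simp only: dsbgs_step_average[OF assms])
  also have "\<dots> = landweber_step (\<alpha> / frob_sq A) A b (dsbgs_expect Rows Cols \<alpha> A b x0 k)"
    unfolding dsbgs_expect_def
    by (rule landweber_step_average) (simp add: sum_lists_prod_list sum_block_prob[OF assms])
  finally show ?thesis .
qed

lemma landweber_step_residual:
  fixes A :: "real^'n^'m"
  assumes "transpose A ** A *v xs = transpose A *v b"
  shows "A *v landweber_step c A b x - A *v xs
       = (A *v x - A *v xs) - c *\<^sub>R (A *v (transpose A *v (A *v x - A *v xs)))"
proof -
  have "transpose A *v (A *v x - b) = transpose A *v (A *v x - A *v xs)"
    using assms by (simp add: matrix_vector_mult_diff_distrib matrix_vector_mul_assoc)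
  then show ?thesis
    by (simp add: landweber_step_def matrix_vector_mult_diff_distrib matrix_vector_mult_scaleR)
qed

lemma geometric_bound_of_step_bound:
  fixes e :: "nat \<Rightarrow> real"
  assumes "\<And>k. e (Suc k) \<le> s * e k" and "s \<ge> 0"
  shows "e k \<le> s ^ k * e 0"
proof (induction k)
  case (Suc k)
  then have "s * e k \<le> s * (s ^ k * e 0)"
    using \<open>s \<ge> 0\<close> by (rule mult_left_mono)
  then show ?case
    using assms(1)[of k] by (simp add: mult.assoc)
qed simp

lemma dsbgs_expect_residual_bound:
  fixes A :: "real^'n::finite^'m::finite"
  assumes "A \<noteq> 0" and "is_partition Rows" and "is_partition Cols" and "\<alpha> > 0"
    and normal: "transpose A ** A *v xs = transpose A *v b"
  obtains \<sigma> where "\<sigma> \<in> nonzero_singular_values A"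
    "\<And>k. norm (A *v dsbgs_expect Rows Cols \<alpha> A b x0 k - A *v xs)
       \<le> \<bar>1 - \<alpha> * \<sigma>\<^sup>2 / frob_sq A\<bar> ^ k * norm (A *v x0 - A *v xs)"
proof -
  define c where "c = \<alpha> / frob_sq A"
  have "c > 0"
    using \<open>\<alpha> > 0\<close> frob_sq_pos[OF \<open>A \<noteq> 0\<close>] by (simp add: c_def)
  then obtain \<sigma> where \<sigma>: "\<sigma> \<in> nonzero_singular_values A"
    and contract: "\<And>y. y \<in> range ((*v) A) \<Longrightarrow>
       norm (y - c *\<^sub>R (A *v (transpose A *v y))) \<le> \<bar>1 - c * \<sigma>\<^sup>2\<bar> * norm y"
    using residual_map_norm_le_on_range[OF \<open>A \<noteq> 0\<close>] by blast
  define e where "e k = A *v dsbgs_expect Rows Cols \<alpha> A b x0 k - A *v xs" for k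
  have "norm (e (Suc k)) \<le> \<bar>1 - c * \<sigma>\<^sup>2\<bar> * norm (e k)" for k
  proof -
    have "e k \<in> range ((*v) A)"
      by (simp add: e_def matrix_vector_mult_diff_distrib[symmetric])
    moreover have "e (Suc k) = e k - c *\<^sub>R (A *v (transpose A *v e k))"
      unfolding e_def dsbgs_expect_Suc[OF assms(1-3)] c_def[symmetric] landweber_step_residual[OF normal] ..
    ultimately show ?thesis
      using contract by simp
  qed
  then have "norm (e k) \<le> \<bar>1 - c * \<sigma>\<^sup>2\<bar> ^ k * norm (e 0)" for k
    by (rule geometric_bound_of_step_bound) simp
  then show ?thesis
    using that[OF \<sigma>] by (simp add: e_def c_def dsbgs_expect_0)
qed

theorem theorem2:
  fixes A :: "real^'n::finite^'m::finite" and b :: "real^'m" and x0 xs :: "real^'n"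
    and Rows :: "'m set set" and Cols :: "'n set set" and \<alpha> :: real and k :: nat
  assumes "A \<noteq> 0"
    and "is_partition Rows" and "is_partition Cols"
    and "\<alpha> > 0"
    and "transpose A ** A *v xs = transpose A *v b"
  shows "norm (A *v dsbgs_expect Rows Cols \<alpha> A b x0 k - A *v xs)
         \<le> (Max ((\<lambda>\<sigma>. \<bar>1 - \<alpha> * \<sigma>\<^sup>2 / frob_sq A\<bar>) ` nonzero_singular_values A)) ^ k
            * norm (A *v x0 - A *v xs)"
proof -
  let ?rate = "\<lambda>\<sigma>. \<bar>1 - \<alpha> * \<sigma>\<^sup>2 / frob_sq A\<bar>"
  obtain \<sigma> where \<sigma>: "\<sigma> \<in> nonzero_singular_values A"
    and bound: "norm (A *v dsbgs_expect Rows Cols \<alpha> A b x0 k - A *v xs) \<le> ?rate \<sigma> ^ k * norm (A *v x0 - A *v xs)"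
    using dsbgs_expect_residual_bound[OF assms] by blast
  have "?rate \<sigma> \<le> Max (?rate ` nonzero_singular_values A)"
    using \<sigma> finite_nonzero_singular_values by (intro Max_ge) auto
  then have "?rate \<sigma> ^ k * norm (A *v x0 - A *v xs)
      \<le> Max (?rate ` nonzero_singular_values A) ^ k * norm (A *v x0 - A *v xs)"
    by (intro mult_right_mono power_mono) auto
  with bound show ?thesis by linarith
qed

end
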